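(* Let $G$ be a group with monoid presentation $\mathrm{mon}\langle X_G, R_G\rangle$, and let $\theta : X_G^* \to G$ be the natural monoid homomorphism. Let $X_H, X_K \subseteq X_G^*$ be such that $\theta(X_H)$ generates a subgroup $H\le G$ and $\theta(X_K)$ generates a subgroup $K \le G$. Let $H,K$ also denote two new symbols not in $X_G$, let $T_+ = (\{H,K\}\cup X_G)^*$ be the free monoid, and let $T = \{HwK : w \in X_G^*\}\subseteq T_+$. Define $$R = R_G \cup \{(Hh, H) : h \in X_H\} \cup \{(kK, K) : k \in X_K\},$$ let $\to_R$ be the reduction relation generated by $R$ on $T_+$, and let $\stackrel{*}{\leftrightarrow}_R$ be its reflexive, symmetric, transitive closure (the congruence on $T_+$ generated by $R$). Then there is a bijection of sets $$T/\!\stackrel{*}{\leftrightarrow}_R \;\cong\; G/\!\sim,$$ where $g\sim g'$ iff $hgk = g'$ for some $h\in H$, $k \in K$.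
   Context: For a group $G$ and subgroups $H,K$, the double cosets are the equivalence classes of the relation $g\sim g' \iff hgk=g'$ for some $h\in H, k\in K$; the set of double cosets is $H\backslash G/K = G/\!\sim$. A rewriting system $R\subseteq T_+\times T_+$ generates the reduction relation $\to_R$ given by $ulv \to_R urv$ for $(l,r)\in R$, $u,v\in T_+$. *)

theory Defs
  imports "HOL-Algebra.Generated_Groups"
begin

(* The free monoid on an alphabet A is the set "lists A" under append. *)

definition reduction :: "'a set \<Rightarrow> 'a list rel \<Rightarrow> 'a list rel" where
  "reduction A R =
     {(u @ l @ v, u @ r @ v) | u l r v. (l, r) \<in> R \<and> u \<in> lists A \<and> v \<in> lists A}"

(* The restriction is needed because the closure taken over the whole type is
   reflexive also on words that are not over A. *)
definition conversion :: "'a set \<Rightarrow> 'a list rel \<Rightarrow> 'a list rel" where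
  "conversion A R = Restr ((reduction A R \<union> (reduction A R)\<inverse>)\<^sup>*) (lists A)"

definition presented_monoid :: "'a set \<Rightarrow> 'a list rel \<Rightarrow> 'a list set monoid" where
  "presented_monoid X R =
     \<lparr>carrier = lists X // conversion X R,
      mult = (\<lambda>a b. \<Union>u\<in>a. \<Union>v\<in>b. conversion X R `` {u @ v}),
      one = conversion X R `` {[]}\<rparr>"

definition double_coset_rel :: "('g, 'm) monoid_scheme \<Rightarrow> 'g set \<Rightarrow> 'g set \<Rightarrow> 'g rel" where
  "double_coset_rel G H K =
     {(g, g'). g \<in> carrier G \<and> g' \<in> carrier G \<and>
        (\<exists>h\<in>H. \<exists>k\<in>K. h \<otimes>\<^bsub>G\<^esub> g \<otimes>\<^bsub>G\<^esub> k = g')}"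

(* The generators together with the two new symbols H and K. *)
datatype 'x symbol = SymH | SymK | Gen 'x

definition ext_alphabet :: "'x set \<Rightarrow> 'x symbol set" where
  "ext_alphabet X = {SymH, SymK} \<union> Gen ` X"

definition tagged_words :: "'x set \<Rightarrow> 'x symbol list set" where
  "tagged_words X = {[SymH] @ map Gen w @ [SymK] | w. w \<in> lists X}"

definition double_coset_rules ::
    "'x list rel \<Rightarrow> 'x list set \<Rightarrow> 'x list set \<Rightarrow> 'x symbol list rel" where
  "double_coset_rules R_G X_H X_K =
     {(map Gen l, map Gen r) | l r. (l, r) \<in> R_G}
     \<union> {([SymH] @ map Gen h, [SymH]) | h. h \<in> X_H}
     \<union> {(map Gen k @ [SymK], [SymK]) | k. k \<in> X_K}"

end

(* Interpret the words over {H, K} and X_G in the monoid of subsets of G, sending the symbols H and K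
   to the subgroups H and K and a generator x to {theta x}.  Since H theta(h) = H for h in X_H and
   theta(k) K = K for k in X_K, this respects all rules, and HwK is sent to the double coset
   H theta(w) K; so convertible words of T give the same double coset.  Conversely, call two elements
   of G linked if they are represented by words v, w with HvK and HwK convertible; the rules link g
   to s g for s in theta(X_H) and to g s for s in theta(X_K), and as linking is an equivalence
   relation it extends to the generated subgroups, inverses included. *)

theory Submission
  imports Defs
begin

text \<open>Every class is a fibre of \<open>f\<close> on \<open>A\<close>, so its image under
  \<open>f\<close> is a singleton and \<open>the_elem\<close> reads off the common value; different
  classes are different fibres.\<close>

lemma bij_betw_kernel_quotient:
  assumes "\<And>x y. (x, y) \<in> r \<longleftrightarrow> x \<in> A \<and> y \<in> A \<and> f x = f y"
  shows "bij_betw (\<lambda>C. the_elem (f ` C)) (A // r) (f ` A)"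
proof -
  have elem: "the_elem (f ` (r `` {x})) = f x" if "x \<in> A" for x
  proof -
    have "f ` (r `` {x}) = {f x}"
      using assms that by (auto simp: image_iff)
    then show ?thesis by simp
  qed
  show ?thesis
  proof (rule bij_betw_imageI)
    show "inj_on (\<lambda>C. the_elem (f ` C)) (A // r)"
      by (rule inj_onI) (auto elim!: quotientE simp: elem assms)
    have "(\<lambda>C. the_elem (f ` C)) ` (A // r) = (\<lambda>x. the_elem (f ` (r `` {x}))) ` A"
      by (auto simp: quotient_def)
    also have "\<dots> = f ` A"
      by (rule image_cong) (auto simp: elem)
    finally show "(\<lambda>C. the_elem (f ` C)) ` (A // r) = f ` A" .
  qed
qed

section \<open>Conversion\<close>

lemma reductionI:
  "(l, r) \<in> R \<Longrightarrow> u \<in> lists A \<Longrightarrow> v \<in> lists A \<Longrightarrow> (u @ l @ v, u @ r @ v) \<in> reduction A R"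
  unfolding reduction_def by blast

lemma equiv_conversion: "equiv (lists A) (conversion A R)"
proof (rule equivI)
  show "refl_on (lists A) (conversion A R)"
    by (auto simp: conversion_def refl_on_def)
  have "sym ((reduction A R \<union> (reduction A R)\<inverse>)\<^sup>*)"
    by (intro sym_rtrancl sym_Un_converse)
  then show "sym (conversion A R)"
    by (auto simp: conversion_def sym_def)
  show "trans (conversion A R)"
    by (auto simp: conversion_def trans_def intro: rtrancl_trans)
qed (auto simp: conversion_def)

lemma conversion_sym: "(x, y) \<in> conversion A R \<Longrightarrow> (y, x) \<in> conversion A R"
  using equiv_conversion [of A R] by (auto elim!: equivE dest: symD)

lemma conversion_trans:
  "(x, y) \<in> conversion A R \<Longrightarrow> (y, z) \<in> conversion A R \<Longrightarrow> (x, z) \<in> conversion A R"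
  using equiv_conversion [of A R] by (auto elim!: equivE dest: transD)

lemma conversion_in_lists:
  "(x, y) \<in> conversion A R \<Longrightarrow> x \<in> lists A \<and> y \<in> lists A"
  by (simp add: conversion_def)

lemma conversion_rule:
  assumes "(l, r) \<in> R" "l \<in> lists A" "r \<in> lists A"
  shows "(l, r) \<in> conversion A R"
proof -
  have "(l, r) \<in> reduction A R"
    using reductionI [OF assms(1), of "[]" A "[]"] by simp
  then show ?thesis
    using assms(2,3) by (auto simp: conversion_def)
qed

text \<open>A map that sends single steps to single steps sends zigzag chains to zigzag chains. It
  serves twice: for placing words in a context, and for embedding words over the generators into the
  alphabet extended by the two new symbols.\<close>

lemma conversion_map:
  assumes "(x, y) \<in> conversion A R"
    and lists: "\<And>x. x \<in> lists A \<Longrightarrow> f x \<in> lists B"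
    and reduction: "\<And>x y. (x, y) \<in> reduction A R \<Longrightarrow> (f x, f y) \<in> reduction B S"
  shows "(f x, f y) \<in> conversion B S"
proof -
  have "(x, y) \<in> (reduction A R \<union> (reduction A R)\<inverse>)\<^sup>*"
    using assms(1) by (simp add: conversion_def)
  then have "(f x, f y) \<in> (reduction B S \<union> (reduction B S)\<inverse>)\<^sup>*"
    by induction (auto intro: rtrancl_into_rtrancl reduction)
  then show ?thesis
    using conversion_in_lists [OF assms(1)] by (simp add: conversion_def lists)
qed

lemma conversion_context:
  assumes "(x, y) \<in> conversion A R" and a: "a \<in> lists A" and b: "b \<in> lists A"
  shows "(a @ x @ b, a @ y @ b) \<in> conversion A R"
proof (rule conversion_map [OF assms(1)])
  fix x y assume "(x, y) \<in> reduction A R"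
  then obtain u l r v where "x = u @ l @ v" "y = u @ r @ v" "(l, r) \<in> R"
    "u \<in> lists A" "v \<in> lists A"
    by (auto simp: reduction_def)
  then have "a @ x @ b = (a @ u) @ l @ (v @ b)" "a @ y @ b = (a @ u) @ r @ (v @ b)"
    "(l, r) \<in> R" "a @ u \<in> lists A" "v @ b \<in> lists A"
    using a b by auto
  then show "(a @ x @ b, a @ y @ b) \<in> reduction A R"
    unfolding reduction_def by blast
qed (use a b in auto)

lemma conversion_append:
  assumes "(u, u') \<in> conversion A R" "(v, v') \<in> conversion A R"
  shows "(u @ v, u' @ v') \<in> conversion A R"
  using conversion_context [OF assms(1), of "[]" v] conversion_context [OF assms(2), of u' "[]"]
    conversion_in_lists [OF assms(1)] conversion_in_lists [OF assms(2)]
  by (auto intro: conversion_trans)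

text \<open>Induction along a zigzag chain, a backward step being covered by the symmetry of
  equality. Applied to \<open>word_value\<close>, this yields the soundness half of the
  theorem.\<close>

lemma conversion_invariant:
  assumes "(x, y) \<in> conversion A R"
    and step: "\<And>x y. (x, y) \<in> reduction A R \<Longrightarrow> f x = f y"
  shows "f x = f y"
proof -
  have "(x, y) \<in> (reduction A R \<union> (reduction A R)\<inverse>)\<^sup>*"
    using assms(1) by (simp add: conversion_def)
  then show ?thesis
    by induction (auto dest: step)
qed

section \<open>Relations invariant under translation by generators\<close>

context group
begin

text \<open>The elements that move every \<open>g\<close> within its class are closed under products
  by transitivity and under inverses by symmetry. The induction keeps \<open>g\<close> arbitrary,
  since both of these cases change the base point.\<close>

lemma generate_left_translation:
  assumes "equiv (carrier G) E" and S: "S \<subseteq> carrier G"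
    and step: "\<And>s g. s \<in> S \<Longrightarrow> g \<in> carrier G \<Longrightarrow> (g, s \<otimes> g) \<in> E"
    and "h \<in> generate G S" "g \<in> carrier G"
  shows "(g, h \<otimes> g) \<in> E"
  using assms(4,5)
proof (induction h arbitrary: g)
  case one
  with assms(1) show ?case by (auto elim!: equivE dest: refl_onD)
next
  case (incl h)
  then show ?case by (rule step)
next
  case (inv h)
  then have "h \<in> carrier G" using S by auto
  \<comment> \<open>The generator is applied at the base point \<open>inv h \<otimes> g\<close>,
    which it moves to \<open>g\<close>; symmetry then reverses this step.\<close>
  with inv have "h \<otimes> (inv h \<otimes> g) = g" by (simp add: m_assoc [symmetric])
  moreover have "(inv h \<otimes> g, h \<otimes> (inv h \<otimes> g)) \<in> E"
    using inv \<open>h \<in> carrier G\<close> by (intro step) auto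
  ultimately show ?case using assms(1) by (auto elim!: equivE dest: symD)
next
  case (eng h1 h2)
  then have "h1 \<in> carrier G" "h2 \<in> carrier G"
    using generate_incl [OF S] by auto
  with eng have "(g, h2 \<otimes> g) \<in> E" "(h2 \<otimes> g, h1 \<otimes> h2 \<otimes> g) \<in> E"
    by (simp_all add: m_assoc)
  then show ?case using assms(1) by (auto elim!: equivE dest: transD)
qed

text \<open>Mirror image of the left version; a product now passes through
  \<open>g \<otimes> h1\<close>, so the first factor acts first.\<close>

lemma generate_right_translation:
  assumes "equiv (carrier G) E" and S: "S \<subseteq> carrier G"
    and step: "\<And>s g. s \<in> S \<Longrightarrow> g \<in> carrier G \<Longrightarrow> (g, g \<otimes> s) \<in> E"
    and "h \<in> generate G S" "g \<in> carrier G"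
  shows "(g, g \<otimes> h) \<in> E"
  using assms(4,5)
proof (induction h arbitrary: g)
  case one
  with assms(1) show ?case by (auto elim!: equivE dest: refl_onD)
next
  case (incl h)
  then show ?case by (rule step)
next
  case (inv h)
  then have "h \<in> carrier G" using S by auto
  with inv have "(g \<otimes> inv h) \<otimes> h = g" by (simp add: m_assoc)
  moreover have "(g \<otimes> inv h, (g \<otimes> inv h) \<otimes> h) \<in> E"
    using inv \<open>h \<in> carrier G\<close> by (intro step) auto
  ultimately show ?case using assms(1) by (auto elim!: equivE dest: symD)
next
  case (eng h1 h2)
  then have "h1 \<in> carrier G" "h2 \<in> carrier G"
    using generate_incl [OF S] by auto
  with eng have "(g, g \<otimes> h1) \<in> E" "(g \<otimes> h1, g \<otimes> (h1 \<otimes> h2)) \<in> E"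
    by (simp_all add: m_assoc [symmetric])
  then show ?case using assms(1) by (auto elim!: equivE dest: transD)
qed

end

section \<open>Group presentations\<close>

text \<open>The isomorphism \<open>\<phi>\<close> expresses that the monoid presentation defines the
  group, and \<open>\<theta>\<close> is the quotient map followed by \<open>\<phi>\<close>,
  prescribed on words over \<open>X\<close> only.\<close>

locale group_presentation = group G for G :: "('g, 'm) monoid_scheme" (structure) +
  fixes X :: "'x set" and R :: "'x list rel"
    and \<phi> :: "'x list set \<Rightarrow> 'g" and \<theta> :: "'x list \<Rightarrow> 'g"
  assumes rules: "R \<subseteq> lists X \<times> lists X"
    and iso: "\<phi> \<in> iso (presented_monoid X R) G"
    and \<theta>_eq: "\<And>w. w \<in> lists X \<Longrightarrow> \<theta> w = \<phi> (conversion X R `` {w})"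
begin

lemma bij_\<phi>: "bij_betw \<phi> (lists X // conversion X R) (carrier G)"
  using iso by (simp add: iso_def presented_monoid_def)

lemma \<theta>_closed [simp]: "w \<in> lists X \<Longrightarrow> \<theta> w \<in> carrier G"
  using bij_\<phi> by (auto simp: \<theta>_eq bij_betw_def intro: quotientI)

lemma \<theta>_surj:
  assumes "g \<in> carrier G" obtains w where "w \<in> lists X" "\<theta> w = g"
proof -
  obtain C where "C \<in> lists X // conversion X R" "\<phi> C = g"
    using bij_betw_imp_surj_on [OF bij_\<phi>] assms by (metis imageE)
  then show thesis using that by (metis \<theta>_eq quotientE)
qed

lemma \<theta>_eq_iff:
  assumes "u \<in> lists X" "v \<in> lists X"
  shows "\<theta> u = \<theta> v \<longleftrightarrow> (u, v) \<in> conversion X R"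
proof -
  have "\<theta> u = \<theta> v \<longleftrightarrow> conversion X R `` {u} = conversion X R `` {v}"
    using bij_\<phi> assms
    by (auto simp: \<theta>_eq bij_betw_def
        dest!: inj_onD intro: quotientI)
  then show ?thesis
    using eq_equiv_class_iff [OF equiv_conversion assms] by simp
qed

text \<open>The product of two classes is a union over all pairs of representatives. As conversion
  is a congruence, every pair contributes the same class, so the union collapses and
  multiplicativity of \<open>\<phi>\<close> applies.\<close>

lemma \<theta>_append:
  assumes u: "u \<in> lists X" and v: "v \<in> lists X"
  shows "\<theta> (u @ v) = \<theta> u \<otimes> \<theta> v"
proof -
  let ?c = "\<lambda>w. conversion X R `` {w}"
  have self: "u \<in> ?c u" "v \<in> ?c v"
    using u v by (simp_all only: equiv_class_self [OF equiv_conversion])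
  have "?c (u' @ v') = ?c (u @ v)" if "u' \<in> ?c u" "v' \<in> ?c v" for u' v'
  proof -
    have "(u @ v, u' @ v') \<in> conversion X R"
      using that by (auto intro: conversion_append)
    then show ?thesis by (metis equiv_class_eq [OF equiv_conversion])
  qed
  then have "(\<Union>u'\<in>?c u. \<Union>v'\<in>?c v. ?c (u' @ v')) =
      (\<Union>u'\<in>?c u. \<Union>v'\<in>?c v. ?c (u @ v))"
    by (intro SUP_cong refl)
  \<comment> \<open>Both index sets are nonempty because a class contains its representative;
    otherwise the union would be empty.\<close>
  also have "\<dots> = ?c (u @ v)"
    using self by (simp only: UN_constant) (metis empty_iff)
  finally have "(\<Union>u'\<in>?c u. \<Union>v'\<in>?c v. ?c (u' @ v')) = ?c (u @ v)" .
  moreover have "\<phi> (mult (presented_monoid X R) (?c u) (?c v)) = \<phi> (?c u) \<otimes> \<phi> (?c v)"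
    using u v quotientI [of _ "lists X" "conversion X R"] iso
    by (intro hom_mult)
      (simp_all only: iso_def presented_monoid_def mem_Collect_eq partial_object.simps)
  ultimately show ?thesis
    using u v by (simp add: \<theta>_eq presented_monoid_def)
qed

text \<open>The image of the empty word is idempotent, and cancellation in a group leaves only the
  unit.\<close>

lemma \<theta>_Nil [simp]: "\<theta> [] = \<one>"
  using \<theta>_append [of "[]" "[]"] \<theta>_closed [of "[]"] by (simp add: l_cancel_one')

end

section \<open>Double cosets\<close>

locale double_coset_presentation = group_presentation G X R \<phi> \<theta>
  for G :: "('g, 'm) monoid_scheme" (structure)
    and X :: "'x set" and R :: "'x list rel"
    and \<phi> :: "'x list set \<Rightarrow> 'g" and \<theta> :: "'x list \<Rightarrow> 'g" +
  fixes X_H X_K :: "'x list set" and H K :: "'g set"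
  assumes X_H: "X_H \<subseteq> lists X" and X_K: "X_K \<subseteq> lists X"
    and H_eq: "H = generate G (\<theta> ` X_H)" and K_eq: "K = generate G (\<theta> ` X_K)"
begin

abbreviation "conv \<equiv> conversion (ext_alphabet X) (double_coset_rules R X_H X_K)"

abbreviation tag :: "'x list \<Rightarrow> 'x symbol list" where
  "tag w \<equiv> [SymH] @ map Gen w @ [SymK]"

lemma \<theta>_X_H: "\<theta> ` X_H \<subseteq> carrier G" and \<theta>_X_K: "\<theta> ` X_K \<subseteq> carrier G"
  using X_H X_K by (blast intro: \<theta>_closed)+

lemma subgroup_H: "subgroup H G" and subgroup_K: "subgroup K G"
  unfolding H_eq K_eq using \<theta>_X_H \<theta>_X_K by (simp_all add: generate_is_subgroup)

lemma map_Gen_lists: "w \<in> lists X \<Longrightarrow> map Gen w \<in> lists (ext_alphabet X)"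
  by (auto simp: ext_alphabet_def)

lemma Sym_lists: "[SymH] \<in> lists (ext_alphabet X)" "[SymK] \<in> lists (ext_alphabet X)"
  by (auto simp: ext_alphabet_def)

lemma tag_lists: "w \<in> lists X \<Longrightarrow> tag w \<in> lists (ext_alphabet X)"
  by (auto simp: ext_alphabet_def)

subsection \<open>Words as subsets of the group\<close>

primrec symbol_value :: "'x symbol \<Rightarrow> 'g set" where
  "symbol_value SymH = H"
| "symbol_value SymK = K"
| "symbol_value (Gen x) = {\<theta> [x]}"

primrec word_value :: "'x symbol list \<Rightarrow> 'g set" where
  "word_value [] = {\<one>}"
| "word_value (s # z) = symbol_value s <#> word_value z"

lemma symbol_value_closed: "s \<in> ext_alphabet X \<Longrightarrow> symbol_value s \<subseteq> carrier G"
  using subgroup.subset [OF subgroup_H] subgroup.subset [OF subgroup_K]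
  by (auto simp: ext_alphabet_def)

lemma word_value_closed: "z \<in> lists (ext_alphabet X) \<Longrightarrow> word_value z \<subseteq> carrier G"
  by (induction z) (auto simp: symbol_value_closed set_mult_closed)

lemma one_set_mult: "A \<subseteq> carrier G \<Longrightarrow> {\<one>} <#> A = A"
  by (force simp: set_mult_def)

lemma set_mult_one: "A \<subseteq> carrier G \<Longrightarrow> A <#> {\<one>} = A"
  by (force simp: set_mult_def)

text \<open>Associativity of the subset product makes \<open>word_value\<close> a monoid
  homomorphism, so a rule used in a context affects only the middle factor of the value.\<close>

lemma word_value_append:
  assumes "z \<in> lists (ext_alphabet X)" "z' \<in> lists (ext_alphabet X)"
  shows "word_value (z @ z') = word_value z <#> word_value z'"
  using assms(1)
proof (induction z)
  case Nil
  show ?case using word_value_closed [OF assms(2)] by (simp add: one_set_mult)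
next
  case (Cons s z)
  then show ?case
    using word_value_closed [OF assms(2)] word_value_closed [of z]
    by (simp add: set_mult_assoc symbol_value_closed)
qed

lemma word_value_map_Gen: "w \<in> lists X \<Longrightarrow> word_value (map Gen w) = {\<theta> w}"
proof (induction w)
  case (Cons x w)
  then show ?case using \<theta>_append [of "[x]" w] by (auto simp: set_mult_def)
qed simp

lemma word_value_Sym: "word_value [SymH] = H" "word_value [SymK] = K"
  using subgroup.subset [OF subgroup_H] subgroup.subset [OF subgroup_K]
  by (simp_all add: set_mult_one)

lemma word_value_tag: "w \<in> lists X \<Longrightarrow> word_value (tag w) = H <#> ({\<theta> w} <#> K)"
  using map_Gen_lists [of w] Sym_lists
  by (simp only: word_value_append word_value_map_Gen word_value_Sym append_in_lists_conv simp_thms)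

lemma double_coset_class:
  assumes "g \<in> carrier G"
  shows "double_coset_rel G H K `` {g} = H <#> ({g} <#> K)"
proof -
  \<comment> \<open>Closure is recorded along with associativity because
    \<open>double_coset_rel\<close> requires both related elements to lie in the carrier.\<close>
  have sub: "h \<otimes> g \<otimes> k = h \<otimes> (g \<otimes> k)" "h \<otimes> (g \<otimes> k) \<in> carrier G"
    if "h \<in> H" "k \<in> K" for h k
    using assms subgroup.mem_carrier [OF subgroup_H that(1)]
      subgroup.mem_carrier [OF subgroup_K that(2)]
    by (simp_all add: m_assoc)
  have "double_coset_rel G H K `` {g} = {h \<otimes> g \<otimes> k | h k. h \<in> H \<and> k \<in> K}"
    using assms sub by (auto simp: double_coset_rel_def) (metis sub)+
  also have "\<dots> = {h \<otimes> (g \<otimes> k) | h k. h \<in> H \<and> k \<in> K}"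
    using sub(1) by metis
  also have "\<dots> = H <#> ({g} <#> K)"
    by (auto simp: set_mult_def)
  finally show ?thesis .
qed

section \<open>Invariance of subset values under the rewriting rules\<close>

lemma H_set_mult: "h \<in> X_H \<Longrightarrow> H <#> {\<theta> h} = H"
  using subgroup_H coset_join2 [of "\<theta> h" H] \<theta>_X_H generate.incl [of "\<theta> h" "\<theta> ` X_H" G]
  by (simp add: H_eq r_coset_eq_set_mult [symmetric] image_subset_iff)

lemma K_set_mult: "k \<in> X_K \<Longrightarrow> {\<theta> k} <#> K = K"
  using subgroup_K coset_join3 [of "\<theta> k" K] \<theta>_X_K generate.incl [of "\<theta> k" "\<theta> ` X_K" G]
  by (simp add: K_eq l_coset_eq_set_mult [symmetric] image_subset_iff)

lemma double_coset_rules_cases: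
  assumes "(l, r) \<in> double_coset_rules R X_H X_K"
  obtains (Gen) l' r' where "l = map Gen l'" "r = map Gen r'" "(l', r') \<in> R"
      "l' \<in> lists X" "r' \<in> lists X"
  | (H) h where "l = [SymH] @ map Gen h" "r = [SymH]" "h \<in> X_H" "h \<in> lists X"
  | (K) k where "l = map Gen k @ [SymK]" "r = [SymK]" "k \<in> X_K" "k \<in> lists X"
  using assms rules X_H X_K unfolding double_coset_rules_def by blast

text \<open>A rule of \<open>R\<close> relates words with the same image under
  \<open>\<theta>\<close>; the other rules are absorption of a generator by its subgroup. Membership
  in the alphabet is included for later uses of \<open>word_value_append\<close> and
  \<open>conversion_rule\<close>.\<close>

lemma word_value_rule:
  assumes "(l, r) \<in> double_coset_rules R X_H X_K"
  shows "l \<in> lists (ext_alphabet X) \<and> r \<in> lists (ext_alphabet X) \<and> word_value l = word_value r"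
  using assms
proof (cases rule: double_coset_rules_cases)
  case (Gen l' r')
  then have "\<theta> l' = \<theta> r'" using \<theta>_eq_iff conversion_rule by blast
  with Gen map_Gen_lists show ?thesis by (simp add: word_value_map_Gen)
next
  case (H h)
  then have "word_value l = word_value r"
    using map_Gen_lists [of h] Sym_lists
    by (simp only: word_value_append word_value_map_Gen word_value_Sym H_set_mult)
  with H Sym_lists map_Gen_lists show ?thesis by (simp)
next
  case (K k)
  then have "word_value l = word_value r"
    using map_Gen_lists [of k] Sym_lists
    by (simp only: word_value_append word_value_map_Gen word_value_Sym K_set_mult)
  with K Sym_lists map_Gen_lists show ?thesis by (simp)
qed

lemma word_value_conv:
  assumes "(z, z') \<in> conv" shows "word_value z = word_value z'"
proof (rule conversion_invariant [OF assms])
  fix x y assume "(x, y) \<in> reduction (ext_alphabet X) (double_coset_rules R X_H X_K)"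
  then obtain u l r v where "x = u @ l @ v" "y = u @ r @ v"
    "(l, r) \<in> double_coset_rules R X_H X_K"
    "u \<in> lists (ext_alphabet X)" "v \<in> lists (ext_alphabet X)"
    unfolding reduction_def by blast
  with word_value_rule show "word_value x = word_value y"
    by (simp add: word_value_append)
qed

subsection \<open>Convertibility of words in the same double coset\<close>

lemma conv_map_Gen:
  assumes "(u, v) \<in> conversion X R" shows "(map Gen u, map Gen v) \<in> conv"
proof (rule conversion_map [OF assms map_Gen_lists])
  fix x y assume "(x, y) \<in> reduction X R"
  then obtain u l r v where *: "x = u @ l @ v" "y = u @ r @ v" "(l, r) \<in> R"
    "u \<in> lists X" "v \<in> lists X"
    unfolding reduction_def by blast
  have "(map Gen l, map Gen r) \<in> double_coset_rules R X_H X_K"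
    using *(3) by (auto simp: double_coset_rules_def)
  from reductionI [OF this map_Gen_lists [OF *(4)] map_Gen_lists [OF *(5)]]
  show "(map Gen x, map Gen y) \<in> reduction (ext_alphabet X) (double_coset_rules R X_H X_K)"
    by (simp only: *(1,2) map_append)
qed

text \<open>Words with equal image are convertible by the rules of the presentation alone, and these
  conversions can be carried out between the two end symbols.\<close>

lemma conv_tag:
  assumes "u \<in> lists X" "v \<in> lists X" "\<theta> u = \<theta> v"
  shows "(tag u, tag v) \<in> conv"
  using assms \<theta>_eq_iff Sym_lists by (intro conversion_context conv_map_Gen) auto

text \<open>The rule for \<open>h\<close> read backwards lets the symbol \<open>SymH\<close> emit
  \<open>h\<close> to its right.\<close>

lemma conv_tag_left:
  assumes h: "h \<in> X_H" and w: "w \<in> lists X"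
  shows "(tag w, tag (h @ w)) \<in> conv"
proof -
  have "([SymH] @ map Gen h, [SymH]) \<in> double_coset_rules R X_H X_K"
    using h by (auto simp: double_coset_rules_def)
  then have "([SymH] @ map Gen h, [SymH]) \<in> conv"
    using word_value_rule by (blast intro: conversion_rule)
  from conversion_context [OF this, of "[]" "map Gen w @ [SymK]"]
  have "(tag (h @ w), tag w) \<in> conv"
    using map_Gen_lists [OF w] Sym_lists by simp
  then show ?thesis by (rule conversion_sym)
qed

lemma conv_tag_right:
  assumes k: "k \<in> X_K" and w: "w \<in> lists X"
  shows "(tag w, tag (w @ k)) \<in> conv"
proof -
  have "(map Gen k @ [SymK], [SymK]) \<in> double_coset_rules R X_H X_K"
    using k by (auto simp: double_coset_rules_def)
  then have "(map Gen k @ [SymK], [SymK]) \<in> conv"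
    using word_value_rule by (blast intro: conversion_rule)
  from conversion_context [OF this, of "[SymH] @ map Gen w" "[]"]
  have "(tag (w @ k), tag w) \<in> conv"
    using map_Gen_lists [OF w] Sym_lists by simp
  then show ?thesis by (rule conversion_sym)
qed

text \<open>Convertibility is moved from words to group elements because the inverse of a generator
  of \<open>H\<close> or \<open>K\<close> comes with no distinguished word, whereas in the group the
  translation lemmas handle it directly.\<close>

definition linked :: "'g rel" where
  "linked = {(\<theta> u, \<theta> v) | u v. u \<in> lists X \<and> v \<in> lists X \<and> (tag u, tag v) \<in> conv}"

text \<open>Independence of the chosen representatives: by \<open>conv_tag\<close>, replacing a word
  by another with the same image does not leave the conversion class of its tagged form.\<close>

lemma linked_iff:
  assumes u: "u \<in> lists X" and v: "v \<in> lists X"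
  shows "(\<theta> u, \<theta> v) \<in> linked \<longleftrightarrow> (tag u, tag v) \<in> conv"
proof
  assume "(\<theta> u, \<theta> v) \<in> linked"
  then obtain u' v' where *: "u' \<in> lists X" "v' \<in> lists X" "\<theta> u = \<theta> u'" "\<theta> v' = \<theta> v"
    "(tag u', tag v') \<in> conv"
    unfolding linked_def by force
  have "(tag u, tag u') \<in> conv" "(tag v', tag v) \<in> conv"
    using * u v by (auto simp del: append.simps intro!: conv_tag)
  with *(5) show "(tag u, tag v) \<in> conv"
    by (blast intro: conversion_trans)
qed (use u v in \<open>auto simp: linked_def\<close>)

lemma equiv_linked: "equiv (carrier G) linked"
proof (rule equivI)
  show closed: "linked \<subseteq> carrier G \<times> carrier G"
    unfolding linked_def using \<theta>_closed by blast
  show "refl_on (carrier G) linked"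
    by (rule refl_onI) (metis \<theta>_surj conv_tag linked_iff)
  show "sym linked"
    by (rule symI) (auto simp: linked_def intro: conversion_sym)
  show "trans linked"
  proof (rule transI)
    fix a b c assume *: "(a, b) \<in> linked" "(b, c) \<in> linked"
    then have "a \<in> carrier G" "b \<in> carrier G" "c \<in> carrier G"
      using closed by blast+
    \<comment> \<open>A single word \<open>v\<close> for the middle element serves both pairs, so
      that the two conversions can be composed.\<close>
    then obtain u v w where uvw:
      "u \<in> lists X" "v \<in> lists X" "w \<in> lists X" "\<theta> u = a" "\<theta> v = b" "\<theta> w = c"
      by (elim \<theta>_surj)
    then have "(tag u, tag v) \<in> conv" "(tag v, tag w) \<in> conv"
      using * by (simp_all only: linked_iff [symmetric])
    then have "(tag u, tag w) \<in> conv" by (rule conversion_trans)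
    then show "(a, c) \<in> linked"
      using uvw by (simp only: linked_iff [symmetric])
  qed
qed

lemma linked_left: "h \<in> H \<Longrightarrow> g \<in> carrier G \<Longrightarrow> (g, h \<otimes> g) \<in> linked"
  unfolding H_eq
proof (rule generate_left_translation [OF equiv_linked \<theta>_X_H])
  fix s g assume "s \<in> \<theta> ` X_H" "g \<in> carrier G"
  then obtain h w where *: "h \<in> X_H" "s = \<theta> h" "w \<in> lists X" "g = \<theta> w"
    by (elim imageE \<theta>_surj) simp
  then have "h \<in> lists X" using X_H by blast
  with * have "(\<theta> w, \<theta> (h @ w)) \<in> linked"
    by (simp only: linked_iff conv_tag_left append_in_lists_conv simp_thms)
  with * \<open>h \<in> lists X\<close> show "(g, s \<otimes> g) \<in> linked"
    by (simp only: \<theta>_append)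
qed

lemma linked_right: "k \<in> K \<Longrightarrow> g \<in> carrier G \<Longrightarrow> (g, g \<otimes> k) \<in> linked"
  unfolding K_eq
proof (rule generate_right_translation [OF equiv_linked \<theta>_X_K])
  fix s g assume "s \<in> \<theta> ` X_K" "g \<in> carrier G"
  then obtain k w where *: "k \<in> X_K" "s = \<theta> k" "w \<in> lists X" "g = \<theta> w"
    by (elim imageE \<theta>_surj) simp
  then have "k \<in> lists X" using X_K by blast
  with * have "(\<theta> w, \<theta> (w @ k)) \<in> linked"
    by (simp only: linked_iff conv_tag_right append_in_lists_conv simp_thms)
  with * \<open>k \<in> lists X\<close> show "(g, g \<otimes> s) \<in> linked"
    by (simp only: \<theta>_append)
qed

text \<open>The two factors are inserted one at a time, passing from \<open>g\<close> through
  \<open>h \<otimes> g\<close> to \<open>g'\<close>.\<close>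

lemma double_coset_rel_linked:
  assumes "(g, g') \<in> double_coset_rel G H K" shows "(g, g') \<in> linked"
proof -
  obtain h k where *: "g \<in> carrier G" "h \<in> H" "k \<in> K" "h \<otimes> g \<otimes> k = g'"
    using assms by (auto simp: double_coset_rel_def)
  moreover from this have "h \<otimes> g \<in> carrier G"
    using subgroup.mem_carrier [OF subgroup_H] by blast
  ultimately have "(g, h \<otimes> g) \<in> linked" "(h \<otimes> g, g') \<in> linked"
    using linked_left linked_right by blast+
  then show ?thesis using equiv_linked by (auto elim!: equivE dest: transD)
qed

subsection \<open>The bijection\<close>

lemma word_value_tag_class:
  "w \<in> lists X \<Longrightarrow> word_value (tag w) = double_coset_rel G H K `` {\<theta> w}"
  by (simp only: word_value_tag double_coset_class \<theta>_closed)

lemma conv_tag_iff: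
  assumes u: "u \<in> lists X" and v: "v \<in> lists X"
  shows "(tag u, tag v) \<in> conv \<longleftrightarrow> word_value (tag u) = word_value (tag v)"
proof
  assume "word_value (tag u) = word_value (tag v)"
  \<comment> \<open>Reflexivity, with the unit as both factors. Since the two classes coincide,
    \<open>\<theta> v\<close> then also lies in the class of \<open>\<theta> u\<close>.\<close>
  moreover have "\<theta> v \<in> double_coset_rel G H K `` {\<theta> v}"
    using \<theta>_closed [OF v] subgroup.one_closed [OF subgroup_H] subgroup.one_closed [OF subgroup_K]
    by (auto simp: double_coset_rel_def intro!: bexI [of _ \<one>])
  ultimately have "(\<theta> u, \<theta> v) \<in> double_coset_rel G H K"
    using u v by (simp only: word_value_tag_class) blast
  then show "(tag u, tag v) \<in> conv"
    using u v double_coset_rel_linked linked_iff by blast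
qed (rule word_value_conv)

text \<open>Surjectivity of \<open>\<theta>\<close> lets the double cosets of images of words
  exhaust all double cosets.\<close>

lemma word_value_image: "word_value ` tagged_words X = carrier G // double_coset_rel G H K"
proof -
  have "word_value ` tagged_words X = (\<lambda>w. word_value (tag w)) ` lists X"
    unfolding tagged_words_def by blast
  also have "\<dots> = (\<lambda>w. double_coset_rel G H K `` {\<theta> w}) ` lists X"
    by (rule image_cong) (simp_all only: word_value_tag_class)
  also have "\<dots> = (\<lambda>g. double_coset_rel G H K `` {g}) ` \<theta> ` lists X"
    by (simp only: image_image)
  also have "\<theta> ` lists X = carrier G"
    by (metis \<theta>_closed \<theta>_surj image_eqI image_subsetI subsetI subset_antisym)
  finally show ?thesis by (auto simp: quotient_def)
qed

text \<open>By \<open>conv_tag_iff\<close>, conversion of tagged words is the kernel of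
  \<open>word_value\<close>. The bijection sends a class to the common value of its words, which is
  the double coset itself.\<close>

theorem bij_betw_double_cosets:
  "bij_betw (\<lambda>C. the_elem (word_value ` C)) (tagged_words X // Restr conv (tagged_words X))
    (carrier G // double_coset_rel G H K)"
  unfolding word_value_image [symmetric]
proof (rule bij_betw_kernel_quotient)
  show "(x, y) \<in> Restr conv (tagged_words X) \<longleftrightarrow>
      x \<in> tagged_words X \<and> y \<in> tagged_words X \<and> word_value x = word_value y" for x y
    unfolding tagged_words_def using conv_tag_iff by blast
qed

end

theorem mainTheorem1:
  fixes G :: "('g, 'm) monoid_scheme"
    and X_G :: "'x set" and R_G :: "'x list rel"
    and \<phi> :: "'x list set \<Rightarrow> 'g" and \<theta> :: "'x list \<Rightarrow> 'g"
    and X_H X_K :: "'x list set" and H K :: "'g set"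
  assumes "group G"
    and "R_G \<subseteq> lists X_G \<times> lists X_G"
    and "\<phi> \<in> iso (presented_monoid X_G R_G) G"
    and "\<And>w. w \<in> lists X_G \<Longrightarrow> \<theta> w = \<phi> (conversion X_G R_G `` {w})"
    and "X_H \<subseteq> lists X_G" and "X_K \<subseteq> lists X_G"
    and "H = generate G (\<theta> ` X_H)" and "K = generate G (\<theta> ` X_K)"
  shows "\<exists>f. bij_betw f
    (tagged_words X_G //
       Restr (conversion (ext_alphabet X_G) (double_coset_rules R_G X_H X_K)) (tagged_words X_G))
    (carrier G // double_coset_rel G H K)"
proof -
  interpret group G by fact
  interpret double_coset_presentation G X_G R_G \<phi> \<theta> X_H X_K H K
    by unfold_locales fact+
  show ?thesis using bij_betw_double_cosets by blast
qed

end
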